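(* Let $K_1,K_2\subset\mathbb{R}$ be Cantor sets (each given by a construction as in the context), where the convex hull of $K_i$ is $[A_i,B_i]$ with $A_i>0$, $i=1,2$. Suppose $$A_1s_{min}(B_2-A_2)-B_2\,\kappa\,(B_1-A_1)\ge0\quad\text{and}\quad A_2s_{min}(B_1-A_1)-B_1\,\kappa\,(B_2-A_2)\ge0.$$ Then for any real numbers $a,b\in\mathbb{R}\setminus\{0\}$, $$aK_1\cap bK_2\neq\emptyset\quad\text{if and only if}\quad \frac ba\in\frac{F_1^{(1)}}{F_1^{(2)}}=\Big\{\frac xy: x\in F_1^{(1)},\ y\in F_1^{(2)}\Big\}.$$
   Context: Cantor sets: start with a closed interval $F_0=[A,B]$. In the first step remove $n_1-1$ open intervals from $[A,B]$ so that $n_1\ge 2$ closed intervals remain; $F_1$ is the union of these. Inductively, given $F_k$ (a finite union of closed intervals), from each of its closed intervals remove finitely many (at least one) open intervals so that $m$ closed intervals remain after removing $m-1$ open ones ($m\ge2$ may depend on the interval); $F_{k+1}$ is the union of all remaining closed intervals. The set $K=\bigcap_{k\ge1}F_k$ is called a Cantor set; its convex hull is $[A,B]$. The deleted open intervals are the gaps of $K$, and the closed intervals making up each $F_k$, $k\ge1$, are the bridges of $K$. For a bridge $I$ of $F_k$, $k\ge1$, its father $\hat I$ is the unique interval of $F_{k-1}$ containing $I$. For a gap $G$ deleted in the $k$-th step, $k\ge1$, its father $\hat G$ is the unique interval of $F_{k-1}$ containing $G$. For $K_1,K_2$, write $F_k^{(i)}$ for the $k$-th stage of the construction of $K_i$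 (so $F_1^{(i)}$ is the union of the first-step bridges of $K_i$). With $|\cdot|$ denoting length, $$s_{min}=\min_{i=1,2}\inf\{|I|/|\hat I|: I\text{ is a bridge of }K_i\},$$ $$\kappa=\max_{i=1,2}\sup\{|G|/|\hat G|: G\text{ is a gap of }K_i\text{ with }G\subset F_1^{(i)}\}$$ (so first-step gaps are not counted in $\kappa$). For $a\in\mathbb{R}$, $aK=\{ax:x\in K\}$. *)

theory Defs
  imports "HOL-Analysis.Analysis"
begin

text \<open>
  One step of the construction inside a closed interval \<open>I\<close>: the open intervals \<open>Gs\<close> are removed
  and the closed intervals \<open>Bs\<close> remain. The remaining intervals have to be nondegenerate, since
  otherwise the construction could not be continued in them; in particular gaps neither abut each
  other nor contain or touch an endpoint of \<open>I\<close>. The cardinality clause yields at least two bridges.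
\<close>

definition removal_step :: "real set \<Rightarrow> real set set \<Rightarrow> real set set \<Rightarrow> bool" where
  "removal_step I Bs Gs \<longleftrightarrow>
     finite Gs \<and> Gs \<noteq> {} \<and> (\<forall>G\<in>Gs. \<exists>c d. c < d \<and> G = {c<..<d}) \<and>
     pairwise disjnt Gs \<and> \<Union>Gs \<subseteq> I \<and>
     finite Bs \<and> card Bs = card Gs + 1 \<and> (\<forall>J\<in>Bs. \<exists>c d. c < d \<and> J = {c..d}) \<and>
     pairwise disjnt Bs \<and> \<Union>Bs = I - \<Union>Gs"

text \<open>
  \<open>Br k\<close> is the set of closed intervals making up the \<open>k\<close>-th stage (so the bridges are the members
  of \<open>Br k\<close> for \<open>k \<ge> 1\<close>), and \<open>Gp k\<close> is the set of gaps deleted in the \<open>k\<close>-th step, \<open>k \<ge> 1\<close>;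
  \<open>Gp 0\<close> is irrelevant.
\<close>

definition cantor_construction ::
    "real \<Rightarrow> real \<Rightarrow> (nat \<Rightarrow> real set set) \<Rightarrow> (nat \<Rightarrow> real set set) \<Rightarrow> bool" where
  "cantor_construction A B Br Gp \<longleftrightarrow>
     A < B \<and> Br 0 = {{A..B}} \<and>
     (\<forall>k. (\<forall>I\<in>Br k. removal_step I {J \<in> Br (Suc k). J \<subseteq> I} {G \<in> Gp (Suc k). G \<subseteq> I}) \<and>
          (\<forall>J\<in>Br (Suc k). \<exists>I\<in>Br k. J \<subseteq> I) \<and>
          (\<forall>G\<in>Gp (Suc k). \<exists>I\<in>Br k. G \<subseteq> I))"

definition stage :: "(nat \<Rightarrow> real set set) \<Rightarrow> nat \<Rightarrow> real set" where
  "stage Br k = \<Union>(Br k)"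

definition cantor_set :: "(nat \<Rightarrow> real set set) \<Rightarrow> real set" where
  "cantor_set Br = (\<Inter>k\<in>{1..}. stage Br k)"

text \<open>The father of a bridge or gap \<open>X\<close> of the \<open>k\<close>-th step; used only for \<open>k \<ge> 1\<close>.\<close>

definition father :: "(nat \<Rightarrow> real set set) \<Rightarrow> nat \<Rightarrow> real set \<Rightarrow> real set" where
  "father Br k X = (THE I. I \<in> Br (k - 1) \<and> X \<subseteq> I)"

abbreviation len :: "real set \<Rightarrow> real" where
  "len I \<equiv> measure lborel I"

definition bridge_ratios :: "(nat \<Rightarrow> real set set) \<Rightarrow> real set" where
  "bridge_ratios Br = {len I / len (father Br k I) | k I. k \<ge> 1 \<and> I \<in> Br k}"

definition gap_ratios :: "(nat \<Rightarrow> real set set) \<Rightarrow> (nat \<Rightarrow> real set set) \<Rightarrow> real set" where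
  "gap_ratios Br Gp =
     {len G / len (father Br k G) | k G. k \<ge> 1 \<and> G \<in> Gp k \<and> G \<subseteq> stage Br 1}"

definition s_min :: "(nat \<Rightarrow> real set set) \<Rightarrow> (nat \<Rightarrow> real set set) \<Rightarrow> real" where
  "s_min Br1 Br2 = min (Inf (bridge_ratios Br1)) (Inf (bridge_ratios Br2))"

definition kappa ::
    "(nat \<Rightarrow> real set set) \<Rightarrow> (nat \<Rightarrow> real set set) \<Rightarrow>
     (nat \<Rightarrow> real set set) \<Rightarrow> (nat \<Rightarrow> real set set) \<Rightarrow> real" where
  "kappa Br1 Gp1 Br2 Gp2 = max (Sup (gap_ratios Br1 Gp1)) (Sup (gap_ratios Br2 Gp2))"

text \<open>The definite description in \<open>father\<close> is meaningful.\<close>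

lemma removal_stepD:
  assumes "removal_step I Bs Gs"
  shows "pairwise disjnt Bs" "J \<in> Bs \<Longrightarrow> J \<noteq> {}" "G \<in> Gs \<Longrightarrow> G \<noteq> {}"
proof -
  show "pairwise disjnt Bs" using assms by (simp add: removal_step_def)
  have "\<forall>J\<in>Bs. \<exists>c d. c < d \<and> J = {c..d}" "\<forall>G\<in>Gs. \<exists>c d. c < d \<and> G = {c<..<d}"
    using assms by (simp_all add: removal_step_def)
  then show "J \<in> Bs \<Longrightarrow> J \<noteq> {}" "G \<in> Gs \<Longrightarrow> G \<noteq> {}" by fastforce+
qed

lemma cantor_constructionD:
  assumes "cantor_construction A B Br Gp"
  shows "Br 0 = {{A..B}}"
    "I \<in> Br k \<Longrightarrow> removal_step I {J \<in> Br (Suc k). J \<subseteq> I} {G \<in> Gp (Suc k). G \<subseteq> I}"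
    "X \<in> Br (Suc k) \<or> X \<in> Gp (Suc k) \<Longrightarrow> \<exists>I\<in>Br k. X \<subseteq> I"
  using assms by (auto simp: cantor_construction_def)

lemma pairwise_disjnt_Br:
  assumes "cantor_construction A B Br Gp"
  shows "pairwise disjnt (Br k)"
proof (induction k)
  case 0
  then show ?case using cantor_constructionD(1)[OF assms] by simp
next
  case (Suc k)
  show ?case
  proof (rule pairwiseI)
    fix J J' assume J: "J \<in> Br (Suc k)" "J' \<in> Br (Suc k)" "J \<noteq> J'"
    from J cantor_constructionD(3)[OF assms] obtain I I'
      where I: "I \<in> Br k" "J \<subseteq> I" "I' \<in> Br k" "J' \<subseteq> I'" by metis
    show "disjnt J J'"
    proof (cases "I = I'")
      case True
      note removal_stepD(1)[OF cantor_constructionD(2)[OF assms I(1)]]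
      from pairwiseD[OF this, of J J'] J I True show ?thesis by simp
    next
      case False
      from pairwiseD[OF Suc I(1) I(3) False] have "disjnt I I'" .
      with I show ?thesis by (meson disjnt_subset1 disjnt_subset2)
    qed
  qed
qed

lemma father_unique:
  assumes "cantor_construction A B Br Gp" "X \<in> Br (Suc k) \<or> X \<in> Gp (Suc k)"
  shows "\<exists>!I. I \<in> Br k \<and> X \<subseteq> I"
proof -
  from cantor_constructionD(3)[OF assms] obtain I where I: "I \<in> Br k" "X \<subseteq> I" ..
  note rs = cantor_constructionD(2)[OF assms(1) I(1)]
  have "X \<noteq> {}"
    using assms(2) I(2) removal_stepD(2)[OF rs, of X] removal_stepD(3)[OF rs, of X] by blast
  show ?thesis
  proof (rule ex1I[of _ I])
    show "I \<in> Br k \<and> X \<subseteq> I" using I by simp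
  next
    fix I' assume I': "I' \<in> Br k \<and> X \<subseteq> I'"
    have "\<not> disjnt I' I" using I I' \<open>X \<noteq> {}\<close> unfolding disjnt_def by blast
    then show "I' = I"
      using pairwiseD[OF pairwise_disjnt_Br[OF assms(1)], of I' k I] I(1) I' by blast
  qed
qed

end

theory Submission
  imports Defs
begin

text \<open>
  Put \<open>t = b / a\<close> and write \<open>s\<close> for \<open>s\<^sub>m\<^sub>i\<^sub>n\<close>; only \<open>t > 0\<close> matters, and the question is whether \<open>K\<^sub>1\<close> meets \<open>t K\<^sub>2\<close>. One
  direction is immediate from \<open>K\<^sub>i \<subseteq> F\<^sub>1\<^sup>(\<^sup>i\<^sup>)\<close>. For the other one, follow pairs of bridges \<open>I\<close> of
  \<open>K\<^sub>1\<close> and \<open>J\<close> of \<open>K\<^sub>2\<close> such that \<open>I\<close> meets \<open>t J\<close> and the lengths \<open>\<bar>I\<bar>\<close> and \<open>\<bar>t J\<bar>\<close> are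
  comparable: each is at least \<open>\<kappa>\<close> times the other (\<open>linked\<close>). The pairs start with first-step
  bridges, so that only gaps counted in \<open>\<kappa>\<close> have to be dealt with.

  Comparability makes refinement possible. A gap removed from \<open>I\<close> has length at most
  \<open>\<kappa> \<bar>I\<bar> \<le> \<bar>t J\<bar>\<close>, so the closed interval \<open>t J\<close> does not fit into it, and therefore \<open>t J\<close> meets one
  of the bridges \<open>I'\<close> that remain of \<open>I\<close> (\<open>child_bridge_meets\<close>). If \<open>I\<close> is the longer one of the two
  intervals, then \<open>\<bar>I'\<bar> \<ge> s \<bar>I\<bar> \<ge> s \<bar>t J\<bar> \<ge> \<kappa> \<bar>t J\<bar>\<close> as soon as \<open>\<kappa> \<le> s\<close>, so comparability persists
  (\<open>linked_refine\<close>); if \<open>t J\<close> is longer, exchange the roles. Each refinement shortens the longer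
  interval by a factor at most \<open>1 - s\<close>, hence the sum of both lengths tends to \<open>0\<close>
  (\<open>linked_arbitrarily_short\<close>). Short bridges belong to late stages, so each stage of \<open>K\<^sub>1\<close> meets
  \<open>t\<close> times the same stage of \<open>K\<^sub>2\<close>, and compactness gives a common point of \<open>K\<^sub>1\<close> and \<open>t K\<^sub>2\<close>.

  The two numerical hypotheses enter twice. Together they give \<open>\<kappa> \<le> s\<close>. Separately, they say that
  two first-step bridges \<open>I\<close> and \<open>J\<close> such that \<open>I\<close> meets \<open>t J\<close> are already comparable, because then
  \<open>A\<^sub>1 / B\<^sub>2 \<le> t \<le> B\<^sub>1 / A\<^sub>2\<close>.
\<close>

section \<open>Bridges and gaps of a single Cantor set\<close>

context
  fixes A B :: real and Br Gp :: "nat \<Rightarrow> real set set"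
  assumes construction: "cantor_construction A B Br Gp"
begin

lemma hull_nondegenerate: "A < B"
  using construction by (simp add: cantor_construction_def)

lemma bridge_removal_step:
  "I \<in> Br k \<Longrightarrow> removal_step I {J \<in> Br (Suc k). J \<subseteq> I} {G \<in> Gp (Suc k). G \<subseteq> I}"
  by (rule cantor_constructionD(2)[OF construction])

lemma bridge_father_exists: "J \<in> Br (Suc k) \<Longrightarrow> \<exists>I\<in>Br k. J \<subseteq> I"
  using cantor_constructionD(3)[OF construction] by blast

lemma bridge_interval:
  assumes "I \<in> Br k"
  obtains c d where "c < d" "I = {c..d}" "len I = d - c"
proof (cases k)
  case 0
  then show ?thesis
    using assms that hull_nondegenerate cantor_constructionD(1)[OF construction] by auto
next
  case (Suc l)
  with assms obtain I' where I': "I' \<in> Br l" "I \<subseteq> I'"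
    using bridge_father_exists by blast
  with assms Suc bridge_removal_step[OF I'(1)] obtain c d where "c < d" "I = {c..d}"
    unfolding removal_step_def by auto
  with that[of c d] show ?thesis by simp
qed

lemma bridge_len_pos: "I \<in> Br k \<Longrightarrow> 0 < len I"
  by (rule bridge_interval[of I k]) simp_all

lemma gap_interval:
  assumes "I \<in> Br k" "G \<in> Gp (Suc k)" "G \<subseteq> I"
  obtains u v where "u < v" "G = {u<..<v}" "len G = v - u"
proof -
  from bridge_removal_step[OF assms(1)] assms(2,3) obtain u v where "u < v" "G = {u<..<v}"
    unfolding removal_step_def by auto
  with that[of u v] show ?thesis by simp
qed

lemma father_eq:
  assumes "I \<in> Br k" "X \<in> Br (Suc k) \<or> X \<in> Gp (Suc k)" "X \<subseteq> I"
  shows "father Br (Suc k) X = I"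
  unfolding father_def diff_Suc_1
  by (rule the1_equality[OF father_unique[OF construction assms(2)] conjI[OF assms(1,3)]])

lemma bridge_len_ge:
  assumes "I \<in> Br k" "J \<in> Br (Suc k)" "J \<subseteq> I"
  shows "Inf (bridge_ratios Br) * len I \<le> len J"
proof -
  have "bdd_below (bridge_ratios Br)"
    unfolding bridge_ratios_def by (rule bdd_belowI[of _ 0]) auto
  moreover have "len J / len I \<in> bridge_ratios Br"
    unfolding bridge_ratios_def
    using assms father_eq[of I k J] by (auto intro!: exI[of _ "Suc k"] exI[of _ J])
  ultimately have "Inf (bridge_ratios Br) \<le> len J / len I"
    by (rule cInf_lower[rotated])
  then show ?thesis
    using bridge_len_pos[OF assms(1)] by (simp add: pos_le_divide_eq)
qed

lemma gap_len_le_father: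
  assumes "I \<in> Br k" "G \<in> Gp (Suc k)" "G \<subseteq> I"
  shows "len G \<le> len I"
proof -
  obtain c d where I: "I = {c..d}" "len I = d - c"
    using bridge_interval[OF assms(1)] by metis
  obtain u v where G: "u < v" "G = {u<..<v}" "len G = v - u"
    using gap_interval[OF assms] by metis
  have "c \<le> u \<and> v \<le> d"
    using assms(3) G(1) unfolding I G by (simp add: greaterThanLessThan_subseteq_atLeastAtMost_iff)
  then show ?thesis using I G by simp
qed

lemma bdd_above_gap_ratios: "bdd_above (gap_ratios Br Gp)"
proof (rule bdd_aboveI[of _ 1])
  fix r assume "r \<in> gap_ratios Br Gp"
  then obtain k G where k: "k \<ge> 1" "G \<in> Gp k" and r: "r = len G / len (father Br k G)"
    unfolding gap_ratios_def by blast
  from k obtain l where l: "k = Suc l" by (cases k) auto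
  with k obtain I where I: "I \<in> Br l" "G \<subseteq> I"
    using cantor_constructionD(3)[OF construction] by blast
  then show "r \<le> 1"
    using r l k father_eq[of I l G] gap_len_le_father[of I l G] bridge_len_pos[of I l] by simp
qed

lemma stage_Suc_subset: "stage Br (Suc k) \<subseteq> stage Br k"
  unfolding stage_def using bridge_father_exists by blast

lemma stage_antimono: "k \<le> l \<Longrightarrow> stage Br l \<subseteq> stage Br k"
  by (rule lift_Suc_antimono_le[of "stage Br", OF stage_Suc_subset])

lemma bridge_subset_stage: "I \<in> Br l \<Longrightarrow> k \<le> l \<Longrightarrow> I \<subseteq> stage Br k"
  using stage_antimono[of k l] unfolding stage_def by blast

lemma stage_subset_hull: "stage Br k \<subseteq> {A..B}"
  using stage_antimono[of 0 k] cantor_constructionD(1)[OF construction]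
  by (simp add: stage_def)

lemma bridge_len_le_hull:
  assumes "I \<in> Br k"
  shows "len I \<le> B - A"
proof -
  obtain c d where I: "c < d" "I = {c..d}" "len I = d - c"
    using bridge_interval[OF assms] by metis
  have "I \<subseteq> {A..B}"
    using bridge_subset_stage[OF assms order_refl] stage_subset_hull by blast
  then show ?thesis using I by simp
qed

lemma gap_ratio_in:
  assumes "I \<in> Br k" "1 \<le> k" "G \<in> Gp (Suc k)" "G \<subseteq> I"
  shows "len G / len I \<in> gap_ratios Br Gp"
proof -
  have "G \<subseteq> stage Br 1"
    using bridge_subset_stage[OF assms(1,2)] assms(4) by blast
  then show ?thesis
    unfolding gap_ratios_def
    using assms father_eq[of I k G] by (auto intro!: exI[of _ "Suc k"] exI[of _ G])
qed

lemma gap_len_le: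
  assumes "I \<in> Br k" "1 \<le> k" "G \<in> Gp (Suc k)" "G \<subseteq> I"
  shows "len G \<le> Sup (gap_ratios Br Gp) * len I"
  using cSup_upper[OF gap_ratio_in[OF assms] bdd_above_gap_ratios] bridge_len_pos[OF assms(1)]
  by (simp add: pos_divide_le_eq)

lemma child_gap_exists: "I \<in> Br k \<Longrightarrow> \<exists>G\<in>Gp (Suc k). G \<subseteq> I"
  using bridge_removal_step[of I k] by (auto simp: removal_step_def)

lemma other_child_bridge:
  assumes "I \<in> Br k"
  shows "\<exists>J'\<in>Br (Suc k). J' \<subseteq> I \<and> J' \<noteq> J"
proof (rule ccontr)
  let ?Bs = "{J \<in> Br (Suc k). J \<subseteq> I}" and ?Gs = "{G \<in> Gp (Suc k). G \<subseteq> I}"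
  assume "\<not> ?thesis"
  then have "?Bs \<subseteq> {J}" by blast
  then have "card ?Bs \<le> 1"
    using card_mono[of "{J}" ?Bs] by simp
  moreover have "card ?Gs \<noteq> 0" "card ?Bs = card ?Gs + 1"
    using bridge_removal_step[OF assms] unfolding removal_step_def by auto
  ultimately show False by linarith
qed

text \<open>Positivity of \<open>\<kappa>\<close> makes \<open>s\<close> positive by the hypotheses of the theorem, and hence the lengths of
  successive bridges decay geometrically.\<close>

lemma gap_ratios_Sup_pos: "0 < Sup (gap_ratios Br Gp)"
proof -
  obtain I0 where "I0 \<in> Br 0"
    using cantor_constructionD(1)[OF construction] by simp
  then obtain I where I: "I \<in> Br (Suc 0)"
    using other_child_bridge by blast
  then obtain G where G: "G \<in> Gp (Suc (Suc 0))" "G \<subseteq> I"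
    using child_gap_exists by blast
  obtain u v where "u < v" "len G = v - u"
    using gap_interval[OF I G] by metis
  then have "0 < len G" by simp
  also have "len G \<le> Sup (gap_ratios Br Gp) * len I"
    using gap_len_le[OF I _ G] by simp
  finally show ?thesis
    using bridge_len_pos[OF I] by (simp add: zero_less_mult_iff)
qed

text \<open>A bridge leaves room for a brother inside their father, and that brother has at least the
  minimal relative length.\<close>

lemma bridge_len_le:
  assumes "I \<in> Br k" "J \<in> Br (Suc k)" "J \<subseteq> I"
  shows "len J \<le> (1 - Inf (bridge_ratios Br)) * len I"
proof -
  obtain J' where J': "J' \<in> Br (Suc k)" "J' \<subseteq> I" "J' \<noteq> J"
    using other_child_bridge[OF assms(1)] by blast
  have disj: "disjnt J J'"
    using pairwiseD[OF pairwise_disjnt_Br[OF construction] assms(2) J'(1)] J'(3) by blast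
  obtain p q where I: "I = {p..q}" "len I = q - p"
    using bridge_interval[OF assms(1)] by metis
  obtain c d where J: "c < d" "J = {c..d}" "len J = d - c"
    using bridge_interval[OF assms(2)] by metis
  obtain c' d' where J'': "c' < d'" "J' = {c'..d'}" "len J' = d' - c'"
    using bridge_interval[OF J'(1)] by metis
  have "d < c' \<or> d' < c"
  proof (rule ccontr)
    assume "\<not> ?thesis"
    then have "max c c' \<in> J \<inter> J'" using J J'' by auto
    then show False using disj unfolding disjnt_def by blast
  qed
  moreover have "p \<le> c" "d \<le> q" "p \<le> c'" "d' \<le> q"
    using assms(3) J'(2) J J'' I by auto
  ultimately have "len J + len J' \<le> len I"
    using I J J'' by auto
  then show ?thesis
    using bridge_len_ge[OF assms(1) J'(1,2)] by (simp add: algebra_simps)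
qed

lemma bridge_len_lower_bound:
  assumes "0 \<le> s" "s \<le> Inf (bridge_ratios Br)" "I \<in> Br k"
  shows "s ^ k * (B - A) \<le> len I"
  using assms(3)
proof (induction k arbitrary: I)
  case 0
  then show ?case
    using cantor_constructionD(1)[OF construction] hull_nondegenerate by simp
next
  case (Suc k)
  then obtain I' where I': "I' \<in> Br k" "I \<subseteq> I'"
    using bridge_father_exists by blast
  have "s ^ Suc k * (B - A) \<le> s * len I'"
    using mult_left_mono[OF Suc.IH[OF I'(1)] assms(1)] by (simp add: mult.assoc)
  also have "\<dots> \<le> Inf (bridge_ratios Br) * len I'"
    using mult_right_mono[OF assms(2), of "len I'"] by simp
  also have "\<dots> \<le> len I"
    using bridge_len_ge[OF I'(1) Suc.prems I'(2)] .
  finally show ?case .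
qed

lemma finite_stage_bridges: "finite (Br k)"
proof (induction k)
  case 0
  then show ?case using cantor_constructionD(1)[OF construction] by simp
next
  case (Suc k)
  have "Br (Suc k) = (\<Union>I\<in>Br k. {J \<in> Br (Suc k). J \<subseteq> I})"
    using bridge_father_exists by blast
  moreover have "finite {J \<in> Br (Suc k). J \<subseteq> I}" if "I \<in> Br k" for I
    using bridge_removal_step[OF that] unfolding removal_step_def by blast
  ultimately show ?case
    using finite_UN_I[OF Suc, of "\<lambda>I. {J \<in> Br (Suc k). J \<subseteq> I}"] by simp
qed

lemma compact_stage: "compact (stage Br k)"
  unfolding stage_def
proof (rule compact_Union[OF finite_stage_bridges])
  fix I assume "I \<in> Br k"
  then show "compact I" by (rule bridge_interval) simp
qed

lemma cantor_set_subset_stage: "cantor_set Br \<subseteq> stage Br 1"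
  unfolding cantor_set_def by blast

text \<open>Were \<open>S\<close> to meet none of the remaining bridges, then, being connected and too long for a single
  gap, it would contain an endpoint of the gap that it meets. That endpoint lies in \<open>I\<close> but
  in no gap, because the gaps are open and disjoint.\<close>

lemma child_bridge_meets:
  assumes I: "I \<in> Br k"
    and S: "S = {c..d}" "S \<inter> I \<noteq> {}"
    and long: "\<And>G. G \<in> Gp (Suc k) \<Longrightarrow> G \<subseteq> I \<Longrightarrow> len G \<le> d - c"
  shows "\<exists>I'\<in>Br (Suc k). I' \<subseteq> I \<and> S \<inter> I' \<noteq> {}"
proof (rule ccontr)
  assume no: "\<not> ?thesis"
  let ?Gs = "{G \<in> Gp (Suc k). G \<subseteq> I}"
  have disj: "pairwise disjnt ?Gs" and un: "\<Union>{J \<in> Br (Suc k). J \<subseteq> I} = I - \<Union>?Gs"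
    using bridge_removal_step[OF I] unfolding removal_step_def by blast+
  have in_gap: "\<exists>G\<in>?Gs. x \<in> G" if "x \<in> S" "x \<in> I" for x
    using un no that by blast
  obtain x where x: "x \<in> S" "x \<in> I" using S(2) by blast
  obtain G where G: "G \<in> Gp (Suc k)" "G \<subseteq> I" "x \<in> G"
    using in_gap[OF x] by blast
  obtain u v where uv: "u < v" "G = {u<..<v}" "len G = v - u"
    using gap_interval[OF I G(1,2)] by metis
  obtain p q where pq: "I = {p..q}"
    using bridge_interval[OF I] by metis
  have ends: "u \<in> I" "v \<in> I"
    using G(2) uv(1) unfolding pq uv
    by (auto simp: greaterThanLessThan_subseteq_atLeastAtMost_iff)
  have "v - u \<le> d - c" using long[OF G(1,2)] uv(3) by simp
  moreover have "c \<le> x" "x \<le> d" "u < x" "x < v"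
    using x G(3) unfolding S uv by auto
  ultimately have "u \<in> S \<or> v \<in> S" unfolding S(1) by auto
  then obtain e where e: "e = u \<or> e = v" "e \<in> S" "e \<in> I" using ends by blast
  obtain G' where G': "G' \<in> Gp (Suc k)" "G' \<subseteq> I" "e \<in> G'"
    using in_gap[OF e(2,3)] by blast
  obtain u' v' where uv': "G' = {u'<..<v'}"
    using gap_interval[OF I G'(1,2)] by metis
  have "G' \<noteq> G" using e(1) G'(3) uv by auto
  then have "disjnt G' G"
    using pairwiseD[OF disj, of G' G] G G' by blast
  moreover have "open G'" "e \<in> closure G"
    using e(1) uv(1) unfolding uv uv' by auto
  ultimately show False
    using G'(3) open_Int_closure_eq_empty[of G' G] unfolding disjnt_def by blast
qed

end

section \<open>Linked pairs of bridges\<close>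

definition linked :: "real \<Rightarrow> real \<Rightarrow> real set \<Rightarrow> real set \<Rightarrow> bool" where
  "linked t \<kappa> I J \<longleftrightarrow>
     (\<exists>y\<in>J. t * y \<in> I) \<and> \<kappa> * (t * len J) \<le> len I \<and> \<kappa> * len I \<le> t * len J"

text \<open>Rescaling by \<open>1 / t\<close> exchanges the roles of the two Cantor sets, so that only the first one of
  them ever has to be refined explicitly.\<close>

lemma linked_commute:
  assumes "0 < t"
  shows "linked (1 / t) \<kappa> J I \<longleftrightarrow> linked t \<kappa> I J"
proof -
  have "(\<exists>x\<in>I. 1 / t * x \<in> J) \<longleftrightarrow> (\<exists>y\<in>J. t * y \<in> I)"
  proof
    assume "\<exists>x\<in>I. 1 / t * x \<in> J"
    then obtain x where "x \<in> I" "1 / t * x \<in> J" ..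
    then show "\<exists>y\<in>J. t * y \<in> I" using assms by (intro bexI[of _ "1 / t * x"]) auto
  next
    assume "\<exists>y\<in>J. t * y \<in> I"
    then obtain y where "y \<in> J" "t * y \<in> I" ..
    then show "\<exists>x\<in>I. 1 / t * x \<in> J" using assms by (intro bexI[of _ "t * y"]) auto
  qed
  moreover have "\<kappa> * (1 / t * len I) \<le> len J \<longleftrightarrow> \<kappa> * len I \<le> t * len J"
    "\<kappa> * len J \<le> 1 / t * len I \<longleftrightarrow> \<kappa> * (t * len J) \<le> len I"
    using assms by (simp_all add: field_simps)
  ultimately show ?thesis unfolding linked_def by blast
qed

text \<open>The choice of the longer interval is what keeps the lengths comparable: its child may be
  shorter than the other interval, but still has at least \<open>s \<ge> \<kappa>\<close> times the length of the latter.\<close>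

lemma linked_refine:
  assumes K1: "cantor_construction A1 B1 Br1 Gp1" and K2: "cantor_construction A2 B2 Br2 Gp2"
    and t: "0 < t"
    and s: "s \<le> Inf (bridge_ratios Br1)"
    and \<kappa>: "Sup (gap_ratios Br1 Gp1) \<le> \<kappa>" "\<kappa> \<le> s" "0 < \<kappa>"
    and I: "I \<in> Br1 k" "1 \<le> k" and J: "J \<in> Br2 l"
    and linked: "linked t \<kappa> I J"
    and longer: "t * len J \<le> len I"
  shows "\<exists>I'\<in>Br1 (Suc k). linked t \<kappa> I' J \<and> len I' \<le> (1 - s) * len I"
proof -
  obtain c d where cd: "c < d" "J = {c..d}" "len J = d - c"
    using bridge_interval[OF K2 J] by metis
  have tJ: "(\<lambda>y. t * y) ` J = {t * c..t * d}"
    using cd t by (simp add: image_mult_atLeastAtMost)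
  have "len G \<le> t * d - t * c" if "G \<in> Gp1 (Suc k)" "G \<subseteq> I" for G
  proof -
    have "len G \<le> Sup (gap_ratios Br1 Gp1) * len I"
      using gap_len_le[OF K1 I that] .
    also have "\<dots> \<le> \<kappa> * len I"
      using \<kappa>(1) by (simp add: mult_right_mono)
    also have "\<dots> \<le> t * len J"
      using linked by (simp add: linked_def)
    finally show ?thesis using cd by (simp add: algebra_simps)
  qed
  moreover have "(\<lambda>y. t * y) ` J \<inter> I \<noteq> {}"
    using linked unfolding linked_def by blast
  ultimately obtain I' where I': "I' \<in> Br1 (Suc k)" "I' \<subseteq> I" "(\<lambda>y. t * y) ` J \<inter> I' \<noteq> {}"
    using child_bridge_meets[OF K1 I(1) tJ] by blast
  have "\<kappa> * (t * len J) \<le> s * len I"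
    using mult_mono[OF \<kappa>(2) longer] \<kappa> t by simp
  also have "\<dots> \<le> Inf (bridge_ratios Br1) * len I"
    using s by (simp add: mult_right_mono)
  also have "\<dots> \<le> len I'"
    using bridge_len_ge[OF K1 I(1) I'(1,2)] .
  finally have lower: "\<kappa> * (t * len J) \<le> len I'" .
  have "len I' \<le> (1 - Inf (bridge_ratios Br1)) * len I"
    using bridge_len_le[OF K1 I(1) I'(1,2)] .
  also have "\<dots> \<le> (1 - s) * len I"
    using s by (simp add: mult_right_mono)
  finally have upper: "len I' \<le> (1 - s) * len I" .
  also have "\<dots> \<le> 1 * len I"
    using \<kappa> by (intro mult_right_mono) auto
  finally have "\<kappa> * len I' \<le> \<kappa> * len I"
    using \<kappa>(3) by simp
  also have "\<dots> \<le> t * len J"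
    using linked by (simp add: linked_def)
  finally have "linked t \<kappa> I' J"
    using lower I'(3) unfolding linked_def by blast
  with upper I'(1) show ?thesis by blast
qed

text \<open>The longer interval carries at least half of the total length, so removing the fraction \<open>s\<close> of
  it removes at least the fraction \<open>s / 2\<close> of the total.\<close>

lemma linked_arbitrarily_short:
  assumes K1: "cantor_construction A1 B1 Br1 Gp1" and K2: "cantor_construction A2 B2 Br2 Gp2"
    and t: "0 < t"
    and s: "s \<le> Inf (bridge_ratios Br1)" "s \<le> Inf (bridge_ratios Br2)" "s \<le> 1"
    and \<kappa>: "Sup (gap_ratios Br1 Gp1) \<le> \<kappa>" "Sup (gap_ratios Br2 Gp2) \<le> \<kappa>" "\<kappa> \<le> s" "0 < \<kappa>"
    and start: "I0 \<in> Br1 1" "J0 \<in> Br2 1" "linked t \<kappa> I0 J0"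
  shows "\<exists>k\<ge>1. \<exists>l\<ge>1. \<exists>I\<in>Br1 k. \<exists>J\<in>Br2 l. linked t \<kappa> I J \<and>
           len I + t * len J \<le> (1 - s / 2) ^ n * (len I0 + t * len J0)"
proof (induction n)
  case 0
  then show ?case
    by (intro exI[of _ 1] conjI bexI[of _ I0] bexI[of _ J0]) (use start in auto)
next
  case (Suc n)
  then obtain k l I J where kl: "1 \<le> k" "1 \<le> l" and I: "I \<in> Br1 k" and J: "J \<in> Br2 l"
    and linked: "linked t \<kappa> I J"
    and sum: "len I + t * len J \<le> (1 - s / 2) ^ n * (len I0 + t * len J0)"
    by blast
  have contract: "(1 - s / 2) * (len I + t * len J)
      \<le> (1 - s / 2) ^ Suc n * (len I0 + t * len J0)"
    using mult_left_mono[OF sum, of "1 - s / 2"] s(3) by (simp add: mult.assoc)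
  show ?case
  proof (cases "t * len J \<le> len I")
    case True
    obtain I' where I': "I' \<in> Br1 (Suc k)" "linked t \<kappa> I' J" "len I' \<le> (1 - s) * len I"
      using linked_refine[OF K1 K2 t s(1) \<kappa>(1,3,4) I kl(1) J linked True] by blast
    have "s * (t * len J) \<le> s * len I"
      using True \<kappa> by (intro mult_left_mono) auto
    then have "len I' + t * len J \<le> (1 - s / 2) * (len I + t * len J)"
      using I'(3) by (simp add: algebra_simps)
    with contract have "len I' + t * len J \<le> (1 - s / 2) ^ Suc n * (len I0 + t * len J0)"
      by linarith
    then show ?thesis
      using I' J kl by (intro exI[of _ "Suc k"] exI[of _ l] conjI bexI[of _ I'] bexI[of _ J]) simp_all
  next
    case False
    have longer: "1 / t * len I \<le> len J"
      using False t by (simp add: field_simps)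
    have t': "0 < 1 / t" and linked': "linked (1 / t) \<kappa> J I"
      using t linked linked_commute[OF t] by simp_all
    obtain J' where J': "J' \<in> Br2 (Suc l)" "linked (1 / t) \<kappa> J' I" "len J' \<le> (1 - s) * len J"
      using linked_refine[OF K2 K1 t' s(2) \<kappa>(2,3,4) J kl(2) I linked' longer] by blast
    have linked'': "linked t \<kappa> I J'"
      using J'(2) linked_commute[OF t] by simp
    have "s * len I \<le> s * (t * len J)"
      using False \<kappa> by (intro mult_left_mono) auto
    moreover have "t * len J' \<le> t * ((1 - s) * len J)"
      using J'(3) t by (intro mult_left_mono) auto
    ultimately have "len I + t * len J' \<le> (1 - s / 2) * (len I + t * len J)"
      by (simp add: algebra_simps)
    with contract have "len I + t * len J' \<le> (1 - s / 2) ^ Suc n * (len I0 + t * len J0)"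
      by linarith
    then show ?thesis
      using I J' linked'' kl
      by (intro exI[of _ k] exI[of _ "Suc l"] conjI bexI[of _ I] bexI[of _ J']) simp_all
  qed
qed

section \<open>Intersections of Cantor sets\<close>

lemma stages_meet_imp_cantor_sets_meet:
  assumes K1: "cantor_construction A1 B1 Br1 Gp1" and K2: "cantor_construction A2 B2 Br2 Gp2"
    and meet: "\<And>m. stage Br1 m \<inter> (\<lambda>y. t * y) ` stage Br2 m \<noteq> {}"
    and t: "t \<noteq> 0"
  shows "\<exists>y\<in>cantor_set Br2. t * y \<in> cantor_set Br1"
proof -
  let ?Z = "\<lambda>m. stage Br1 m \<inter> (\<lambda>y. t * y) ` stage Br2 m"
  have compact_Z: "compact (?Z m)" for m
    using compact_stage[OF K1] compact_stage[OF K2]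
    by (intro compact_Int compact_continuous_image continuous_intros)
  have antimono_Z: "?Z l \<subseteq> ?Z k" if "k \<le> l" for k l
    by (intro Int_mono image_mono stage_antimono[OF K1 that] stage_antimono[OF K2 that])
  have "\<Inter>(range ?Z) \<noteq> {}"
    by (rule compact_nest[of ?Z, OF compact_Z meet antimono_Z])
  then obtain z where "z \<in> \<Inter>(range ?Z)" by (meson ex_in_conv)
  then have z: "z \<in> ?Z m" for m by (rule INT_D[OF _ UNIV_I])
  have "z / t \<in> stage Br2 m" for m
    using z[of m] t by auto
  then have "z / t \<in> cantor_set Br2" "t * (z / t) \<in> cantor_set Br1"
    using z t unfolding cantor_set_def by auto
  then show ?thesis by blast
qed

text \<open>A bridge of a stage before the \<open>m\<close>-th one has length at least \<open>s\<^sup>m\<close> times the length of the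
  hull, so sufficiently short linked bridges lie in the \<open>m\<close>-th stages.\<close>

lemma cantor_sets_meet_if_linked:
  assumes K1: "cantor_construction A1 B1 Br1 Gp1" and K2: "cantor_construction A2 B2 Br2 Gp2"
    and t: "0 < t"
    and s: "s \<le> Inf (bridge_ratios Br1)" "s \<le> Inf (bridge_ratios Br2)" "s \<le> 1"
    and \<kappa>: "Sup (gap_ratios Br1 Gp1) \<le> \<kappa>" "Sup (gap_ratios Br2 Gp2) \<le> \<kappa>" "\<kappa> \<le> s" "0 < \<kappa>"
    and start: "I0 \<in> Br1 1" "J0 \<in> Br2 1" "linked t \<kappa> I0 J0"
  shows "\<exists>y\<in>cantor_set Br2. t * y \<in> cantor_set Br1"
proof (rule stages_meet_imp_cantor_sets_meet[OF K1 K2])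
  show "t \<noteq> 0" using t by simp
  fix m
  have s0: "0 < s" using \<kappa> by simp
  define \<epsilon> where "\<epsilon> = min (s ^ m * (B1 - A1)) (t * (s ^ m * (B2 - A2)))"
  have "0 < \<epsilon>"
    using s0 t hull_nondegenerate[OF K1] hull_nondegenerate[OF K2] by (simp add: \<epsilon>_def)
  moreover have "(\<lambda>n. (1 - s / 2) ^ n * (len I0 + t * len J0)) \<longlonglongrightarrow> 0"
    using s0 s(3) by (intro tendsto_mult_left_zero LIMSEQ_power_zero) simp
  ultimately have "\<forall>\<^sub>F n in sequentially. (1 - s / 2) ^ n * (len I0 + t * len J0) < \<epsilon>"
    by (simp add: order_tendstoD(2))
  then obtain n where n: "(1 - s / 2) ^ n * (len I0 + t * len J0) < \<epsilon>"
    using eventually_happens trivial_limit_sequentially by blast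
  obtain k l I J where I: "I \<in> Br1 k" and J: "J \<in> Br2 l"
    and linked: "linked t \<kappa> I J"
    and sum: "len I + t * len J \<le> (1 - s / 2) ^ n * (len I0 + t * len J0)"
    using linked_arbitrarily_short[OF K1 K2 t s \<kappa> start] by blast
  have short: "len I < s ^ m * (B1 - A1)" "t * len J < t * (s ^ m * (B2 - A2))"
    using sum n bridge_len_pos[OF K1 I] mult_pos_pos[OF t bridge_len_pos[OF K2 J]]
    unfolding \<epsilon>_def by linarith+
  have "m \<le> k"
  proof (rule ccontr)
    assume "\<not> m \<le> k"
    then have "s ^ m * (B1 - A1) \<le> s ^ k * (B1 - A1)"
      using s0 s(3) hull_nondegenerate[OF K1] by (intro mult_right_mono power_decreasing) auto
    also have "\<dots> \<le> len I"
      using bridge_len_lower_bound[OF K1 _ s(1) I] s0 by simp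
    finally show False using short(1) by simp
  qed
  moreover have "m \<le> l"
  proof (rule ccontr)
    assume "\<not> m \<le> l"
    then have "s ^ m * (B2 - A2) \<le> s ^ l * (B2 - A2)"
      using s0 s(3) hull_nondegenerate[OF K2] by (intro mult_right_mono power_decreasing) auto
    also have "\<dots> \<le> len J"
      using bridge_len_lower_bound[OF K2 _ s(2) J] s0 by simp
    finally show False using short(2) t by simp
  qed
  ultimately have "I \<subseteq> stage Br1 m" "J \<subseteq> stage Br2 m"
    using bridge_subset_stage[OF K1 I] bridge_subset_stage[OF K2 J] by blast+
  then show "stage Br1 m \<inter> (\<lambda>y. t * y) ` stage Br2 m \<noteq> {}"
    using linked unfolding linked_def by blast
qed

text \<open>If \<open>\<kappa>\<close> exceeded \<open>s\<close>, the two hypotheses would chain up to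
  \<open>B\<^sub>2 \<kappa> L\<^sub>1 \<le> A\<^sub>1 s L\<^sub>2 < B\<^sub>1 \<kappa> L\<^sub>2 \<le> A\<^sub>2 s L\<^sub>1 < B\<^sub>2 \<kappa> L\<^sub>1\<close>.\<close>

lemma hypotheses_imp_kappa_le_s:
  fixes A1 B1 L1 A2 B2 L2 s \<kappa> :: real
  assumes "B2 * \<kappa> * L1 \<le> A1 * s * L2" "B1 * \<kappa> * L2 \<le> A2 * s * L1"
    and "0 < A1" "A1 \<le> B1" "0 < A2" "A2 \<le> B2" "0 < L1" "0 < L2" "0 < s"
  shows "\<kappa> \<le> s"
proof (rule ccontr)
  assume "\<not> \<kappa> \<le> s"
  then have "A1 * s < B1 * \<kappa>" "A2 * s < B2 * \<kappa>"
    using assms by (auto intro!: mult_le_less_imp_less)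
  then have "A1 * s * L2 < B1 * \<kappa> * L2" "A2 * s * L1 < B2 * \<kappa> * L1"
    using assms by simp_all
  then show False using assms(1,2) by linarith
qed

theorem theorem1p8:
  fixes A1 B1 A2 B2 :: real
    and Br1 Gp1 Br2 Gp2 :: "nat \<Rightarrow> real set set"
    and a b :: real
  assumes "cantor_construction A1 B1 Br1 Gp1" and "cantor_construction A2 B2 Br2 Gp2"
    and "A1 > 0" and "A2 > 0"
    and "A1 * s_min Br1 Br2 * (B2 - A2) - B2 * kappa Br1 Gp1 Br2 Gp2 * (B1 - A1) \<ge> 0"
    and "A2 * s_min Br1 Br2 * (B1 - A1) - B1 * kappa Br1 Gp1 Br2 Gp2 * (B2 - A2) \<ge> 0"
    and "a \<noteq> 0" and "b \<noteq> 0"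
  shows "(\<lambda>x. a * x) ` cantor_set Br1 \<inter> (\<lambda>x. b * x) ` cantor_set Br2 \<noteq> {} \<longleftrightarrow>
         b / a \<in> {x / y | x y. x \<in> stage Br1 1 \<and> y \<in> stage Br2 1}"
    (is "?meet \<longleftrightarrow> ?ratio")
proof
  note K1 = assms(1) and K2 = assms(2)
  assume ?meet
  then obtain x y where xy: "x \<in> cantor_set Br1" "y \<in> cantor_set Br2" "a * x = b * y"
    by blast
  then have st: "x \<in> stage Br1 1" "y \<in> stage Br2 1"
    using cantor_set_subset_stage[OF K1] cantor_set_subset_stage[OF K2] by blast+
  then have "0 < y"
    using stage_subset_hull[OF K2, of 1] assms(4) by force
  then have "b / a = x / y"
    using xy(3) assms(7) by (simp add: field_simps)
  with st show ?ratio by blast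
next
  note K1 = assms(1) and K2 = assms(2)
  assume ?ratio
  then obtain x y where xy: "x \<in> stage Br1 1" "y \<in> stage Br2 1" "b / a = x / y"
    by blast
  define t where "t = b / a"
  define s where "s = s_min Br1 Br2"
  define \<kappa> where "\<kappa> = kappa Br1 Gp1 Br2 Gp2"
  have hull: "A1 \<le> x" "x \<le> B1" "A2 \<le> y" "y \<le> B2"
    using xy(1,2) stage_subset_hull[OF K1, of 1] stage_subset_hull[OF K2, of 1] by auto
  have y0: "0 < y" and t0: "0 < t" and ty: "t * y = x"
    using hull xy(3) assms(3,4) by (auto simp: t_def)
  have AB: "A1 < B1" "A2 < B2"
    using hull_nondegenerate[OF K1] hull_nondegenerate[OF K2] .
  have s: "s \<le> Inf (bridge_ratios Br1)" "s \<le> Inf (bridge_ratios Br2)"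
    by (auto simp: s_def s_min_def)
  have \<kappa>: "Sup (gap_ratios Br1 Gp1) \<le> \<kappa>" "Sup (gap_ratios Br2 Gp2) \<le> \<kappa>"
    by (auto simp: \<kappa>_def kappa_def)
  have \<kappa>0: "0 < \<kappa>"
    using gap_ratios_Sup_pos[OF K1] \<kappa>(1) by simp
  have h1: "B2 * \<kappa> * (B1 - A1) \<le> A1 * s * (B2 - A2)"
    and h2: "B1 * \<kappa> * (B2 - A2) \<le> A2 * s * (B1 - A1)"
    using assms(5,6) by (simp_all add: s_def \<kappa>_def)
  have "0 < B2 * \<kappa> * (B1 - A1)"
    using \<kappa>0 AB assms(4) by simp
  with h1 have "0 < A1 * s * (B2 - A2)" by simp
  then have s0: "0 < s"
    using AB assms(3) by (simp add: zero_less_mult_iff)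
  have \<kappa>s: "\<kappa> \<le> s"
    using hypotheses_imp_kappa_le_s[OF h1 h2] AB assms(3,4) s0 by simp
  obtain I where I: "I \<in> Br1 1" "x \<in> I" using xy(1) unfolding stage_def by blast
  obtain J where J: "J \<in> Br2 1" "y \<in> J" using xy(2) unfolding stage_def by blast
  have first1: "s * (B1 - A1) \<le> len I" and first2: "s * (B2 - A2) \<le> len J"
    using bridge_len_lower_bound[OF K1 _ s(1) I(1)] bridge_len_lower_bound[OF K2 _ s(2) J(1)] s0
    by simp_all
  have le_hull: "len I \<le> B1 - A1" "len J \<le> B2 - A2"
    using bridge_len_le_hull[OF K1 I(1)] bridge_len_le_hull[OF K2 J(1)] .
  have "s * (B1 - A1) \<le> 1 * (B1 - A1)" using first1 le_hull(1) by simp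
  then have s1: "s \<le> 1" using AB by (simp del: mult_1)
  have tA2: "t * A2 \<le> B1" and tB2: "A1 \<le> t * B2"
    using mult_left_mono[OF hull(3), of t] mult_left_mono[OF hull(4), of t] t0 ty hull by simp_all
  \<comment> \<open>Both length comparisons are shown after multiplication with \<open>A2\<close> and \<open>B2\<close>, respectively,
    which turns the bounds on \<open>t\<close> into division-free ones.\<close>
  have "A2 * (\<kappa> * (t * len J)) = t * A2 * (\<kappa> * len J)" by simp
  also have "\<dots> \<le> B1 * (\<kappa> * (B2 - A2))"
    using tA2 le_hull(2) \<kappa>0 AB assms(3,4) by (intro mult_mono mult_left_mono) auto
  also have "\<dots> \<le> A2 * (s * (B1 - A1))" using h2 by (simp add: mult.assoc)
  also have "\<dots> \<le> A2 * len I" using first1 assms(4) by simp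
  finally have c1: "\<kappa> * (t * len J) \<le> len I" using assms(4) by simp
  have "B2 * (\<kappa> * len I) \<le> B2 * (\<kappa> * (B1 - A1))"
    using le_hull(1) \<kappa>0 AB assms(4) by simp
  also have "\<dots> \<le> A1 * (s * (B2 - A2))" using h1 by (simp add: mult.assoc)
  also have "\<dots> \<le> t * B2 * len J"
    using tB2 first2 s0 t0 AB assms(3,4) by (intro mult_mono) auto
  also have "\<dots> = B2 * (t * len J)" by simp
  finally have c2: "\<kappa> * len I \<le> t * len J" using AB assms(4) by simp
  have "linked t \<kappa> I J"
    using c1 c2 I J ty unfolding linked_def by blast
  from cantor_sets_meet_if_linked[OF K1 K2 t0 s s1 \<kappa> \<kappa>s \<kappa>0 I(1) J(1) this]
  obtain w where w: "w \<in> cantor_set Br2" "t * w \<in> cantor_set Br1" by blast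
  have "a * (t * w) = b * w" using assms(7) by (simp add: t_def)
  with w show ?meet by blast
qed

end
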